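(* For every prime power $q$, an ${\rm Sp}(6,q)$-space has a maximal symplectic partial spread of size $q^3-q^2+1$.
   Context: An ${\rm Sp}(6,q)$-space is a $6$-dimensional $\mathbb{F}_q$-space with a nondegenerate alternating form. A symplectic partial spread is a set of totally isotropic $3$-dimensional subspaces pairwise meeting only in $0$; it is maximal if not properly contained in another symplectic partial spread. *)

theory Defs
  imports "HOL-Number_Theory.Prime_Powers" "HOL-Library.Cardinality"
begin

text \<open>The whole type \<open>'v\<close> is the space; the field \<open>'k\<close> is a vector space over itself via \<open>(*)\<close>.\<close>

locale symplectic_space = vector_space scale
  for scale :: "'k::field \<Rightarrow> 'v::ab_group_add \<Rightarrow> 'v" +
  fixes form :: "'v \<Rightarrow> 'v \<Rightarrow> 'k"
  assumes linear_left: "Vector_Spaces.linear scale (*) (\<lambda>x. form x y)"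
    and linear_right: "Vector_Spaces.linear scale (*) (form x)"
    and alternating: "form x x = 0"
    and nondegenerate: "(\<forall>y. form x y = 0) \<Longrightarrow> x = 0"
begin

definition totally_isotropic :: "'v set \<Rightarrow> bool" where
  "totally_isotropic W \<longleftrightarrow> (\<forall>x\<in>W. \<forall>y\<in>W. form x y = 0)"

end

text \<open>
  As \<open>CARD('k) = 0\<close> for infinite \<open>'k\<close>, and \<open>dim UNIV = 0\<close> for an infinite-dimensional
  space, the assumptions force \<open>'k\<close> and the dimension to be finite (for \<open>q > 0\<close>).
\<close>

locale Sp6_space = symplectic_space scale form
  for q :: nat and scale :: "'k::field \<Rightarrow> 'v::ab_group_add \<Rightarrow> 'v" and form +
  assumes card_field: "CARD('k) = q"
    and dim_6: "dim (UNIV :: 'v set) = 6"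
begin

definition symplectic_partial_spread :: "'v set set \<Rightarrow> bool" where
  "symplectic_partial_spread S \<longleftrightarrow>
     (\<forall>W\<in>S. subspace W \<and> dim W = 3 \<and> totally_isotropic W) \<and>
     (\<forall>U\<in>S. \<forall>W\<in>S. U \<noteq> W \<longrightarrow> U \<inter> W = {0})"

definition maximal_symplectic_partial_spread :: "'v set set \<Rightarrow> bool" where
  "maximal_symplectic_partial_spread S \<longleftrightarrow>
     symplectic_partial_spread S \<and> \<not> (\<exists>T. symplectic_partial_spread T \<and> S \<subset> T)"

end

end

theory Submission
  imports Defs "HOL-Number_Theory.Residues" "HOL-Algebra.Algebraic_Closure_Type"
begin

text \<open>
  Let \<open>F = GF(q)\<close> and \<open>K = GF(q\<^sup>3)\<close> with trace \<open>Tr\<close>, and put \<open>H = ker Tr\<close>. The space is isometric to \<open>K \<times> K\<close> with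
  the form \<open>Tr (x y' - y x')\<close>, and the lines \<open>y = s x\<close> together with \<open>x = 0\<close> form the Desarguesian spread. The totally
  isotropic subspace \<open>W = F \<times> H\<close> meets exactly the \<open>q\<^sup>2 + 1\<close> spread members of slope in \<open>H \<union> {\<infinity>}\<close>; replacing
  these members by \<open>W\<close> gives the partial spread.

  Suppose that \<open>U\<close> could be added to it. The \<open>q\<^sup>3 - 1\<close> nonzero vectors of \<open>U\<close> lie in the \<open>q\<^sup>2 + 1\<close> removed members, so
  \<open>U\<close> meets one of them in a subspace \<open>B\<close> with more than \<open>q\<close> vectors. If it has slope \<open>\<infinity>\<close> and \<open>(u, _) \<in> U\<close> with
  \<open>u \<noteq> 0\<close>, then \<open>B = u H\<close>, and isotropy gives \<open>u\<^sup>2 H \<subseteq> H\<close>; hence \<open>u\<^sup>2 \<in> F\<close>, so \<open>u \<in> F\<close> and \<open>B = H\<close> meets \<open>W\<close>.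
  If its slope is in \<open>H\<close>, a shear makes it \<open>0\<close>. Then the inverses of the nonzero elements of \<open>H\<close>, together with \<open>0\<close>,
  form a subspace. For \<open>h\<close> and \<open>s h\<close> in \<open>H\<close> with \<open>s \<notin> F\<close> this yields \<open>g = h / (1 + s)\<close> with
  \<open>g, g s, g s\<^sup>2 \<in> H\<close>, which forces \<open>g = 0\<close>.
\<close>

section \<open>Cubic extensions of finite fields\<close>

text \<open>Both fields are kept as fixed-point sets inside one ambient field, so that elements of
  \<open>F\<close>, elements of \<open>K\<close> and traces share a type. Iterated
  \<open>q\<close>-th powers stand in for \<open>q ^ 3\<close> so that additivity of Frobenius can
  be applied layer by layer.\<close>

locale cubic_extension =
  fixes q :: nat and field_type :: "'a::field itself"
  assumes q_gt_1: "q > 1"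
    and frob_add: "\<And>x y :: 'a. (x + y) ^ q = x ^ q + y ^ q"
    and card_base: "card {x :: 'a. x ^ q = x} = q"
    and card_ext: "card {x :: 'a. ((x ^ q) ^ q) ^ q = x} = q ^ 3"
begin

definition F :: "'a set" where "F = {x. x ^ q = x}"
definition K :: "'a set" where "K = {x. ((x ^ q) ^ q) ^ q = x}"
definition Tr :: "'a \<Rightarrow> 'a" where "Tr x = x + x ^ q + (x ^ q) ^ q"
definition H :: "'a set" where "H = {x\<in>K. Tr x = 0}"

lemma card_F: "card F = q" and card_K: "card K = q ^ 3"
  using card_base card_ext by (simp_all add: F_def K_def)

lemma finite_F: "finite F" and finite_K: "finite K"
  using card_F card_K q_gt_1 by (auto intro: card_ge_0_finite)

lemma zero_power_q [simp]: "(0::'a) ^ q = 0"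
  using q_gt_1 by simp

lemma frob_minus: "(- x :: 'a) ^ q = - (x ^ q)"
  using frob_add[of x "- x"] by (simp add: eq_neg_iff_add_eq_0 add.commute)

lemma frob_diff: "(x - y :: 'a) ^ q = x ^ q - y ^ q"
  using frob_add[of x "- y"] by (simp add: frob_minus)

lemmas frob_simps = frob_add frob_minus frob_diff power_mult_distrib power_divide

lemma F_closed [simp, intro]:
  "0 \<in> F" "1 \<in> F" "x \<in> F \<Longrightarrow> y \<in> F \<Longrightarrow> x + y \<in> F" "x \<in> F \<Longrightarrow> y \<in> F \<Longrightarrow> x - y \<in> F"
  "x \<in> F \<Longrightarrow> - x \<in> F" "x \<in> F \<Longrightarrow> y \<in> F \<Longrightarrow> x * y \<in> F" "x \<in> F \<Longrightarrow> y \<in> F \<Longrightarrow> x / y \<in> F"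
  by (auto simp: F_def frob_simps)

lemma K_closed [simp, intro]:
  "0 \<in> K" "1 \<in> K" "x \<in> K \<Longrightarrow> y \<in> K \<Longrightarrow> x + y \<in> K" "x \<in> K \<Longrightarrow> y \<in> K \<Longrightarrow> x - y \<in> K"
  "x \<in> K \<Longrightarrow> - x \<in> K" "x \<in> K \<Longrightarrow> y \<in> K \<Longrightarrow> x * y \<in> K" "x \<in> K \<Longrightarrow> y \<in> K \<Longrightarrow> x / y \<in> K"
  by (auto simp: K_def frob_simps)

lemma F_imp_K [simp, intro]: "x \<in> F \<Longrightarrow> x \<in> K"
  by (simp add: F_def K_def)

lemma Tr_0 [simp]: "Tr 0 = 0"
  by (simp add: Tr_def)

lemma Tr_add: "Tr (x + y) = Tr x + Tr y"
  by (simp add: Tr_def frob_simps)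

lemma Tr_diff: "Tr (x - y) = Tr x - Tr y"
  by (simp add: Tr_def frob_simps)

lemma Tr_minus: "Tr (- x) = - Tr x"
  using Tr_diff[of 0 x] by simp

lemma Tr_scale: "c \<in> F \<Longrightarrow> Tr (c * x) = c * Tr x"
  by (simp add: Tr_def F_def frob_simps algebra_simps)

lemma Tr_in_F [simp, intro]: "x \<in> K \<Longrightarrow> Tr x \<in> F"
  by (simp add: Tr_def F_def K_def frob_simps add_ac)

text \<open>With \<open>g\<^sub>i\<close>, \<open>s\<^sub>i\<close> the three conjugates, the hypotheses say \<open>\<Sum>g\<^sub>i = \<Sum>g\<^sub>i s\<^sub>i = \<Sum>g\<^sub>i s\<^sub>i\<^sup>2 = 0\<close>,
  and \<open>s \<notin> F\<close> makes the \<open>s\<^sub>i\<close> distinct, so this is the Vandermonde argument.\<close>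
lemma Tr_vandermonde:
  assumes "s \<in> K" "s \<notin> F" "Tr g = 0" "Tr (g * s) = 0" "Tr (g * s ^ 2) = 0"
  shows "g = 0"
proof -
  define s1 where "s1 = s ^ q"
  define s2 where "s2 = s1 ^ q"
  define g1 where "g1 = g ^ q"
  define g2 where "g2 = g1 ^ q"
  have "s \<noteq> s1"
    using assms by (auto simp: F_def s1_def)
  moreover have "s \<noteq> s2"
  proof
    assume "s = s2"
    then have "s1 = s"
      using \<open>s \<in> K\<close> by (simp add: K_def s1_def s2_def)
    then show False using \<open>s \<noteq> s1\<close> by simp
  qed
  moreover have sq: "(x ^ 2) ^ q = (x ^ q) ^ 2" for x :: 'a
    by (metis mult.commute power_mult)
  have "g + g1 + g2 = 0" "g * s + g1 * s1 + g2 * s2 = 0" "g * s^2 + g1 * s1^2 + g2 * s2^2 = 0"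
    using assms(3-5) by (simp_all add: Tr_def frob_simps sq s1_def s2_def g1_def g2_def)
  moreover have "g * (s - s1) * (s - s2) = (g * s^2 + g1 * s1^2 + g2 * s2^2)
      - (s1 + s2) * (g * s + g1 * s1 + g2 * s2) + s1 * s2 * (g + g1 + g2)"
    by (simp add: algebra_simps power2_eq_square)
  ultimately show ?thesis by simp
qed

lemma K_not_F: obtains t where "t \<in> K" "t \<notin> F"
proof -
  have "card F < card K"
    using q_gt_1 power_strict_increasing[of 1 3 q] by (simp add: card_F card_K)
  then have "\<not> K \<subseteq> F"
    using finite_F card_mono leD by blast
  then show thesis using that by blast
qed

text \<open>Testing \<open>x = 1, t, t * t\<close> for some \<open>t\<close> in \<open>K\<close>
  outside \<open>F\<close> gives the hypotheses of \<open>Tr_vandermonde\<close>.\<close>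

lemma Tr_nondegenerate:
  assumes "\<And>x. x \<in> K \<Longrightarrow> Tr (g * x) = 0"
  shows "g = 0"
proof -
  obtain t where t: "t \<in> K" "t \<notin> F" by (rule K_not_F)
  show ?thesis
    by (rule Tr_vandermonde[OF t])
      (use t assms[of 1] assms[of t] assms[of "t * t"] in \<open>auto simp: power2_eq_square\<close>)
qed

text \<open>In characteristic 3 the trace of \<open>1\<close> is 0, so a suitable element is found
  by rescaling any element of nonzero trace.\<close>

lemma Tr_eq_1: obtains z where "z \<in> K" "Tr z = 1"
proof -
  obtain y where y: "y \<in> K" "Tr y \<noteq> 0"
    using Tr_nondegenerate[of 1] by auto
  then have "Tr (1 / Tr y * y) = 1"
    by (subst Tr_scale) auto
  with y show thesis using that[of "1 / Tr y * y"] by auto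
qed

text \<open>An element \<open>z\<close> of trace 1 splits \<open>K\<close> as the direct sum of
  \<open>F z\<close> and the kernel \<open>H\<close>; the \<open>z\<close>-coordinate of
  \<open>x\<close> is \<open>Tr x\<close>.\<close>

lemma card_H: "card H = q ^ 2"
proof -
  obtain z where z: "z \<in> K" "Tr z = 1" by (rule Tr_eq_1)
  have "bij_betw (\<lambda>(c, h). c * z + h) (F \<times> H) K"
    by (rule bij_betw_byWitness[where f' = "\<lambda>x. (Tr x, x - Tr x * z)"])
       (auto simp: H_def Tr_add Tr_diff Tr_scale z)
  then have "q * card H = q ^ 3"
    using bij_betw_same_card card_F card_K by (metis card_cartesian_product)
  then show ?thesis
    using q_gt_1 by (simp add: power3_eq_cube power2_eq_square)
qed

lemma H_closed [simp, intro]: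
  "0 \<in> H" "x \<in> H \<Longrightarrow> y \<in> H \<Longrightarrow> x + y \<in> H" "x \<in> H \<Longrightarrow> y \<in> H \<Longrightarrow> x - y \<in> H"
  "c \<in> F \<Longrightarrow> x \<in> H \<Longrightarrow> c * x \<in> H"
  by (auto simp: H_def Tr_add Tr_diff Tr_scale)

lemma H_imp_K: "x \<in> H \<Longrightarrow> x \<in> K"
  by (simp add: H_def)

lemma finite_H: "finite H"
  using finite_K by (simp add: H_def)

text \<open>The functional \<open>Tr (u * x)\<close> vanishes on the kernel of \<open>Tr\<close>, so
  it is \<open>c * Tr x\<close> with \<open>c = Tr (u * z)\<close>, and nondegeneracy gives
  \<open>u = c\<close>.\<close>

lemma H_stabilizer:
  assumes "u \<in> K" and stab: "\<And>h. h \<in> H \<Longrightarrow> u * h \<in> H"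
  shows "u \<in> F"
proof -
  obtain z where z: "z \<in> K" "Tr z = 1" by (rule Tr_eq_1)
  define c where "c = Tr (u * z)"
  have c: "c \<in> F" using assms z by (auto simp: c_def)
  have "Tr ((u - c) * x) = 0" if "x \<in> K" for x
  proof -
    have "u * (x - Tr x * z) \<in> H"
      using that z by (intro stab) (auto simp: H_def Tr_diff Tr_scale)
    then have "Tr (u * x) - Tr (Tr x * (u * z)) = 0"
      by (simp add: H_def Tr_diff algebra_simps)
    then show ?thesis
      using that c by (simp add: left_diff_distrib Tr_diff Tr_scale c_def)
  qed
  then have "u - c = 0" by (rule Tr_nondegenerate)
  with c show ?thesis by simp
qed

text \<open>Here \<open>u\<^sup>q = e u\<close> with \<open>e = \<plusminus>1\<close>, and applying Frobenius three times gives \<open>u = e\<^sup>3 u = e u\<close>.\<close>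
lemma square_in_F:
  assumes "u \<in> K" "u * u \<in> F"
  shows "u \<in> F"
proof -
  have "(u ^ q - u) * (u ^ q + u) = 0"
    using assms(2) by (simp add: F_def power_mult_distrib algebra_simps)
  then consider "u ^ q = u" | "u ^ q = - u"
    by (auto simp: eq_neg_iff_add_eq_0)
  then show ?thesis
  proof cases
    case 2
    then have "((u ^ q) ^ q) ^ q = - u"
      by (simp add: frob_minus)
    with 2 assms(1) show ?thesis by (simp add: F_def K_def)
  qed (simp add: F_def)
qed

text \<open>A line over \<open>F\<close> has only \<open>q\<close> elements, so \<open>B\<close>
  contains two independent vectors and all their combinations.\<close>

lemma card_subspace_ge:
  assumes "finite B"
    and add: "\<And>x y. x \<in> B \<Longrightarrow> y \<in> B \<Longrightarrow> x + y \<in> B"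
    and scale: "\<And>c x. c \<in> F \<Longrightarrow> x \<in> B \<Longrightarrow> c * x \<in> B"
    and large: "q < card B"
  shows "q ^ 2 \<le> card B"
proof -
  have "\<not> B \<subseteq> {0}"
    using large q_gt_1 card_mono[of "{0}" B] by auto
  then obtain a where a: "a \<in> B" "a \<noteq> 0" by auto
  have "card ((\<lambda>c. c * a) ` F) \<le> q"
    using card_image_le[OF finite_F, of "\<lambda>c. c * a"] card_F by simp
  then have "\<not> B \<subseteq> (\<lambda>c. c * a) ` F"
    using large card_mono[of "(\<lambda>c. c * a) ` F" B] finite_F by fastforce
  then obtain b where b: "b \<in> B" "b \<notin> (\<lambda>c. c * a) ` F" by auto
  have "inj_on (\<lambda>(c, d). c * a + d * b) (F \<times> F)"
  proof (rule inj_onI, clarify)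
    fix c d c' d' assume F: "c \<in> F" "d \<in> F" "c' \<in> F" "d' \<in> F"
      and eq: "c * a + d * b = c' * a + d' * b"
    have "d = d'"
    proof (rule ccontr)
      assume "d \<noteq> d'"
      then have "b = (c' - c) / (d - d') * a"
        using eq by (simp add: field_simps)
      with b(2) F show False by blast
    qed
    with eq a(2) show "c = c' \<and> d = d'" by simp
  qed
  then have "card ((\<lambda>(c, d). c * a + d * b) ` (F \<times> F)) = q ^ 2"
    by (simp add: card_image card_F power2_eq_square card_cartesian_product)
  moreover have "(\<lambda>(c, d). c * a + d * b) ` (F \<times> F) \<subseteq> B"
    using a b add scale by auto
  ultimately show ?thesis
    using card_mono[OF \<open>finite B\<close>] by metis
qed

text \<open>The basis \<open>1, t, t ^ 2\<close> and its trace-dual basis turn the trace form into a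
  standard dot product, which is later matched with hyperbolic pairs. The dual basis exists because
  \<open>\<tau>\<close> is injective and \<open>K\<close> has as many elements as
  \<open>F \<times> F \<times> F\<close>.\<close>

lemma dual_bases:
  obtains b c :: "nat \<Rightarrow> 'a" where "\<And>i. b i \<in> K" "\<And>i. c i \<in> K"
    "\<And>x y. x \<in> K \<Longrightarrow> y \<in> K \<Longrightarrow> Tr (x * y) = (\<Sum>i<3. Tr (x * b i) * Tr (y * c i))"
proof -
  obtain t where t: "t \<in> K" "t \<notin> F" by (rule K_not_F)
  define \<tau> where "\<tau> x = (Tr x, Tr (x * t), Tr (x * t ^ 2))" for x
  have t2: "t ^ 2 \<in> K" using t by (simp add: power2_eq_square)
  have "inj_on \<tau> K"
  proof (rule inj_onI)
    fix x y assume "\<tau> x = \<tau> y"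
    have "x - y = 0"
      by (rule Tr_vandermonde[OF t])
        (use \<open>\<tau> x = \<tau> y\<close> in \<open>simp_all add: \<tau>_def left_diff_distrib Tr_diff\<close>)
    then show "x = y" by simp
  qed
  moreover have "\<tau> ` K \<subseteq> F \<times> F \<times> F"
    using t t2 by (auto simp: \<tau>_def)
  ultimately have surj: "\<tau> ` K = F \<times> F \<times> F"
    by (intro card_subset_eq)
      (simp_all add: finite_F card_image card_K card_F card_cartesian_product power3_eq_cube)
  have "\<exists>c. c \<in> K \<and> \<tau> c = (of_bool (i = 0), of_bool (i = 1), of_bool (i = 2))" for i :: nat
  proof -
    have "(of_bool (i = 0), of_bool (i = 1), of_bool (i = 2)) \<in> F \<times> F \<times> F"
      by (auto simp: of_bool_def)
    then show ?thesis unfolding surj[symmetric] by auto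
  qed
  then obtain c where c: "\<And>i::nat. c i \<in> K"
    and \<tau>c: "\<And>i. \<tau> (c i) = (of_bool (i = 0), of_bool (i = 1), of_bool (i = 2))"
    by metis
  show thesis
  proof (rule that[of "\<lambda>i. if i = 0 then 1 else if i = 1 then t else t ^ 2" c])
    fix x y assume xy: "x \<in> K" "y \<in> K"
    \<comment> \<open>The error of expanding \<open>x\<close> in the dual basis. Its traces against
      \<open>1, t, t ^ 2\<close> are 0, so it vanishes.\<close>
    define d where "d = x - (\<Sum>i<3. Tr (x * (if i = 0 then 1 else if i = 1 then t else t ^ 2)) * c i)"
    have eq: "x = Tr x * c 0 + Tr (x * t) * c 1 + Tr (x * t ^ 2) * c 2 + d"
      by (simp add: d_def eval_nat_numeral)
    have F: "Tr x \<in> F" "Tr (x * t) \<in> F" "Tr (x * t ^ 2) \<in> F"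
      using xy t t2 by auto
    have *: "Tr (d * s) = Tr (x * s) - (Tr x * Tr (c 0 * s) + Tr (x * t) * Tr (c 1 * s) + Tr (x * t ^ 2) * Tr (c 2 * s))" for s
      using arg_cong[OF eq, of "\<lambda>x. Tr (x * s)"] F
      by (simp add: distrib_right Tr_add Tr_scale mult.assoc)
    have "d = 0"
      by (rule Tr_vandermonde[OF t])
        (use *[of 1] *[of t] *[of "t ^ 2"] \<tau>c[of 0] \<tau>c[of 1] \<tau>c[of 2] in \<open>simp_all add: \<tau>_def\<close>)
    then show "Tr (x * y) = (\<Sum>i<3. Tr (x * (if i = 0 then 1 else if i = 1 then t else t ^ 2)) * Tr (y * c i))"
      using *[of y] by (simp add: eval_nat_numeral mult.commute)
  qed (use c t t2 in auto)
qed

lemma H_nonzero: obtains h where "h \<in> H" "h \<noteq> 0"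
proof -
  have "\<not> H \<subseteq> {0}"
    using card_mono[of "{0}" H] card_H power_strict_increasing[of 0 2 q] q_gt_1 by auto
  then show thesis using that by auto
qed

lemma H_independent:
  assumes "h \<noteq> 0"
  obtains h' where "h' \<in> H" "h' / h \<notin> F"
proof -
  have "card ((\<lambda>c. c * h) ` F) < card H"
    using card_image_le[OF finite_F, of "\<lambda>c. c * h"] power_strict_increasing[of 1 2 q] q_gt_1
    by (simp add: card_F card_H)
  then have "\<not> H \<subseteq> (\<lambda>c. c * h) ` F"
    using card_mono[of "(\<lambda>c. c * h) ` F" H] finite_F by fastforce
  then obtain h' where "h' \<in> H" "h' \<notin> (\<lambda>c. c * h) ` F" by blast
  moreover from this have "h' / h \<notin> F"
    using assms by (metis image_eqI nonzero_eq_divide_eq)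
  ultimately show thesis using that by blast
qed

end

section \<open>Maximality in coordinates\<close>

text \<open>\<open>U\<close> is a further member of the partial spread in the coordinates \<open>K \<times> K\<close>: it avoids \<open>W = F \<times> H\<close>, and by
  \<open>slope\<close> every line \<open>y = s x\<close> with \<open>Tr s \<noteq> 0\<close>.\<close>
locale avoiding_subspace = cubic_extension q field_type
  for q :: nat and field_type :: "'a::field itself" +
  fixes U :: "('a \<times> 'a) set"
  assumes subset_K: "U \<subseteq> K \<times> K"
    and add: "(x, y) \<in> U \<Longrightarrow> (x', y') \<in> U \<Longrightarrow> (x + x', y + y') \<in> U"
    and scale: "c \<in> F \<Longrightarrow> (x, y) \<in> U \<Longrightarrow> (c * x, c * y) \<in> U"
    and isotropic: "(x, y) \<in> U \<Longrightarrow> (x', y') \<in> U \<Longrightarrow> Tr (x * y' - y * x') = 0"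
    and slope: "(x, y) \<in> U \<Longrightarrow> x \<noteq> 0 \<Longrightarrow> y / x \<in> H"
    and avoid: "(c, h) \<in> U \<Longrightarrow> c \<in> F \<Longrightarrow> h \<in> H \<Longrightarrow> c = 0 \<and> h = 0"
    and card_U: "card U = q ^ 3"
begin

lemma card_vertical_le: "card {y. (0, y) \<in> U} \<le> q"
proof (rule ccontr)
  define B where "B = {y. (0, y) \<in> U}"
  assume "\<not> card {y. (0, y) \<in> U} \<le> q"
  then have "q < card B" by (simp add: B_def)
  moreover have fin: "finite B"
    using subset_K by (intro finite_subset[OF _ finite_K]) (auto simp: B_def)
  moreover have "x + y \<in> B" if "x \<in> B" "y \<in> B" for x y
    using that add[of 0 x 0 y] by (simp add: B_def)
  moreover have "c * x \<in> B" if "c \<in> F" "x \<in> B" for c x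
    using that scale[of c 0 x] by (simp add: B_def)
  ultimately have large: "q ^ 2 \<le> card B"
    using card_subspace_ge by blast
  obtain h where h: "h \<in> H" "h \<noteq> 0" by (rule H_nonzero)
  \<comment> \<open>Otherwise \<open>U\<close> would be the whole vertical member, which contains
    \<open>(0, h)\<close> from \<open>W\<close>.\<close>
  obtain u1 u2 where u: "(u1, u2) \<in> U" "u1 \<noteq> 0"
  proof (rule ccontr)
    assume "\<not> thesis"
    then have "U \<subseteq> {0} \<times> K"
      using that subset_K by blast
    then have "U = {0} \<times> K"
      by (intro card_subset_eq) (simp_all add: finite_K card_U card_cartesian_product card_K)
    then show False
      using avoid[of 0 h] h H_imp_K by auto
  qed
  have uK: "u1 \<in> K" "u2 \<in> K" using u subset_K by auto
  have "b / u1 \<in> H" if "b \<in> B" for b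
  proof -
    \<comment> \<open>Both \<open>(u1, u2)\<close> and \<open>(u1, u2 + b)\<close> lie in
      \<open>U\<close>; \<open>b / u1\<close> is the difference of their slopes.\<close>
    have "(u2 + b) / u1 - u2 / u1 \<in> H"
      using that u add[of u1 u2 0 b] by (intro H_closed slope) (auto simp: B_def)
    then show ?thesis by (simp add: add_divide_distrib)
  qed
  moreover have "card ((\<lambda>b. b / u1) ` B) = card B"
    using u by (intro card_image) (auto simp: inj_on_def)
  ultimately have BH: "(\<lambda>b. b / u1) ` B = H"
    using large card_seteq[OF finite_H, of "(\<lambda>b. b / u1) ` B"]
    by (simp add: card_H image_subset_iff)
  \<comment> \<open>Write \<open>b = u1 * h\<close>; isotropy of \<open>(u1, u2)\<close> and
    \<open>(0, b)\<close> says that \<open>u1 * b\<close> has trace 0.\<close>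
  have "u1 * u1 * h \<in> H" if "h \<in> H" for h
  proof -
    obtain b where b: "b \<in> B" "h = b / u1"
      using \<open>h \<in> H\<close> BH by (metis imageE)
    then have "Tr (u1 * b) = 0"
      using isotropic[OF u(1), of 0 b] by (simp add: B_def)
    then show ?thesis
      using b u uK subset_K by (auto simp: H_def B_def)
  qed
  then have "u1 * u1 \<in> F"
    using uK by (intro H_stabilizer) auto
  then have "u1 \<in> F"
    using uK square_in_F by blast
  moreover obtain b where "b \<in> B" "h = b / u1"
    using h(1) BH by (metis imageE)
  ultimately show False
    using avoid[of 0 b] H_closed(4)[of u1 h] h u by (simp add: B_def)
qed

text \<open>Translating \<open>(u1, u2)\<close> by \<open>B\<close> produces enough distinct slopes
  \<open>u2 / (u1 + b)\<close> to fill \<open>H\<close>. Hence \<open>B\<close> consists of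
  \<open>0\<close> and the \<open>u2 / h\<close> with \<open>h\<close> nonzero in \<open>H\<close>,
  and its additivity constrains inverses in \<open>H\<close>.\<close>

lemma card_horizontal_le: "card {x. (x, 0) \<in> U} \<le> q"
proof (rule ccontr)
  define B where "B = {x. (x, 0) \<in> U}"
  assume "\<not> card {x. (x, 0) \<in> U} \<le> q"
  then have "q < card B" by (simp add: B_def)
  moreover have fin: "finite B"
    using subset_K by (intro finite_subset[OF _ finite_K]) (auto simp: B_def)
  moreover have B_add: "x + y \<in> B" if "x \<in> B" "y \<in> B" for x y
    using that add[of x 0 y 0] by (simp add: B_def)
  moreover have B_scale: "c * x \<in> B" if "c \<in> F" "x \<in> B" for c x
    using that scale[of c x 0] by (simp add: B_def)
  ultimately have large: "q ^ 2 \<le> card B"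
    using card_subspace_ge by blast
  have B_minus: "- x \<in> B" if "x \<in> B" for x
    using B_scale[of "-1" x] that by simp
  obtain u1 u2 where u: "(u1, u2) \<in> U" "u2 \<noteq> 0"
  proof (rule ccontr)
    assume "\<not> thesis"
    then have "U \<subseteq> K \<times> {0}"
      using that subset_K by blast
    then have "U = K \<times> {0}"
      by (intro card_subset_eq) (simp_all add: finite_K card_U card_cartesian_product card_K)
    then show False
      using avoid[of 1 0] by auto
  qed
  have slope': "u2 / (u1 + b) \<in> H" if "b \<in> B" for b
    using that slope[of "u1 + b" u2] add[OF u(1), of b 0] by (cases "u1 + b = 0") (auto simp: B_def)
  \<comment> \<open>Injectivity includes a possible zero denominator, because \<open>inverse\<close>
    is injective on the whole field with \<open>inverse 0 = 0\<close>.\<close>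
  moreover have "card ((\<lambda>b. u2 / (u1 + b)) ` B) = card B"
    using u by (intro card_image) (auto simp: inj_on_def divide_inverse)
  ultimately have BH: "(\<lambda>b. u2 / (u1 + b)) ` B = H"
    using large card_seteq[OF finite_H, of "(\<lambda>b. u2 / (u1 + b)) ` B"]
    by (simp add: card_H image_subset_iff)
  \<comment> \<open>The value \<open>0 \<in> H\<close> can only come from the junk value \<open>u2 / 0\<close>.\<close>
  obtain b0 where "b0 \<in> B" "u2 / (u1 + b0) = 0"
    using BH H_closed(1) by (metis imageE)
  then have u1: "u1 \<in> B"
    using u B_minus by (auto simp: add_eq_0_iff2)
  have to_B: "u2 / h \<in> B" if "h \<in> H" for h
  proof -
    obtain b where "b \<in> B" "h = u2 / (u1 + b)"
      using \<open>h \<in> H\<close> BH by (metis imageE)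
    with u u1 B_add show ?thesis by simp
  qed
  have to_H: "u2 / b \<in> H" if "b \<in> B" for b
    using slope'[of "b - u1"] B_add[OF that B_minus[OF u1]] by simp
  obtain h where h: "h \<in> H" "h \<noteq> 0" by (rule H_nonzero)
  obtain h' where h': "h' \<in> H" "h' / h \<notin> F" using H_independent h by blast
  define s where "s = h' / h"
  have s: "s \<in> K" "s \<notin> F" "h' = s * h" "s \<noteq> 0" "1 + s \<noteq> 0"
    using h h' H_imp_K F_closed(5)[of 1] F_closed(1,2)
    by (auto simp: s_def add_eq_0_iff simp del: F_closed)
  \<comment> \<open>Chosen so that \<open>g + g * s = h\<close> and
    \<open>g * s + g * s ^ 2 = h'\<close>, while adding \<open>u2 / h\<close> and
    \<open>u2 / h'\<close> in \<open>B\<close> and inverting back gives \<open>g * s\<close> in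
    \<open>H\<close>. So all three traces needed for \<open>Tr_vandermonde\<close> vanish.\<close>
  define g where "g = h / (1 + s)"
  have "u2 / (u2 / h + u2 / h') \<in> H"
    by (rule to_H[OF B_add[OF to_B[OF h(1)] to_B[OF h'(1)]]])
  also have "u2 / h + u2 / h' = u2 * (1 + s) / (s * h)"
    using h s by (simp add: field_simps)
  also have "u2 / \<dots> = g * s"
    using u by (simp add: g_def)
  finally have g1: "Tr (g * s) = 0" by (simp add: H_def)
  have "g + g * s = h" "g * s + g * s ^ 2 = h'"
    using s by (simp_all add: g_def power2_eq_square divide_simps) (simp_all add: algebra_simps)
  then have "Tr (g + g * s) = 0" "Tr (g * s + g * s ^ 2) = 0"
    using h h' by (simp_all add: H_def)
  then have "g = 0"
    using Tr_vandermonde[OF s(1,2), of g] g1 by (simp add: Tr_add)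
  with h s show False by (simp add: g_def)
qed

text \<open>The shear preserves the form and lowers every slope by \<open>s\<close>. As
  \<open>s\<close> is in \<open>H\<close> and \<open>F\<close> multiplies \<open>H\<close> into
  itself, it also preserves the admissible slopes and \<open>W\<close>.\<close>

lemma shear:
  assumes "s \<in> H"
  shows "avoiding_subspace q ((\<lambda>(x, y). (x, y - s * x)) ` U)"
proof (standard, goal_cases)
  case 1
  then show ?case using subset_K assms H_imp_K by auto
next
  case (2 x y x' y')
  then show ?case using add by (force simp: algebra_simps)
next
  case (3 c x y)
  then show ?case using scale by (force simp: algebra_simps)
next
  case (4 x y x' y')
  then obtain z z' where "(x, z) \<in> U" "y = z - s * x" "(x', z') \<in> U" "y' = z' - s * x'"
    by auto
  then have "x * y' - y * x' = x * z' - z * x'"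
    by (simp only:) (simp add: algebra_simps)
  with \<open>(x, z) \<in> U\<close> \<open>(x', z') \<in> U\<close> show ?case
    using isotropic by simp
next
  case (5 x y)
  then show ?case using slope assms by (auto simp: diff_divide_distrib)
next
  case (6 c h)
  then obtain y where y: "(c, y) \<in> U" "h = y - s * c" by auto
  have "h + c * s \<in> H" using assms 6 by auto
  with y 6 avoid[of c y] show ?case by (simp add: mult.commute)
next
  case 7
  have "inj_on (\<lambda>(x, y). (x, y - s * x)) U" by (auto simp: inj_on_def)
  then show ?case by (simp add: card_image card_U)
qed

lemma card_slope_le:
  assumes "s \<in> H"
  shows "card {x. (x, s * x) \<in> U} \<le> q"
proof -
  interpret sheared: avoiding_subspace q field_type "(\<lambda>(x, y). (x, y - s * x)) ` U"
    using assms by (rule shear)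
  have "{x. (x, 0) \<in> (\<lambda>(x, y). (x, y - s * x)) ` U} = {x. (x, s * x) \<in> U}"
    by force
  then show ?thesis using sheared.card_horizontal_le by simp
qed

text \<open>The \<open>q\<^sup>2 + 1\<close> slopes that \<open>U\<close> may use would each account for at most \<open>q - 1\<close> of its \<open>q\<^sup>3 - 1\<close>
  nonzero vectors.\<close>
lemma contradiction: False
proof -
  define V where "V = {y. (0, y) \<in> U} - {0}"
  define L where "L s = {x. (x, s * x) \<in> U} - {0}" for s
  have fin: "finite {y. (0, y) \<in> U}" "finite {x. (x, s * x) \<in> U}" for s
    using subset_K by (auto intro!: finite_subset[OF _ finite_K])
  have zero: "(0, 0) \<in> U"
  proof -
    have "U \<noteq> {}"
      using card_U q_gt_1 by auto
    then obtain x y where "(x, y) \<in> U" by auto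
    then show ?thesis using scale[of 0 x y] by simp
  qed
  have cV: "card V \<le> q - 1"
    using card_vertical_le fin zero by (simp add: V_def card_Diff_singleton)
  have cL: "card (L s) \<le> q - 1" if "s \<in> H" for s
    using card_slope_le[OF that] fin zero by (simp add: L_def card_Diff_singleton)
  have "card (\<Union>s\<in>H. (\<lambda>x. (x, s * x)) ` L s) \<le> (\<Sum>s\<in>H. card ((\<lambda>x. (x, s * x)) ` L s))"
    by (rule card_UN_le[OF finite_H])
  also have "\<dots> \<le> (\<Sum>s\<in>H. q - 1)"
    by (intro sum_mono order_trans[OF card_image_le cL]) (auto simp: L_def fin)
  finally have "card (\<Union>s\<in>H. (\<lambda>x. (x, s * x)) ` L s) \<le> q ^ 2 * (q - 1)"
    by (simp add: card_H)
  moreover have "card (Pair 0 ` V :: ('a \<times> 'a) set) \<le> q - 1"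
    by (rule order_trans[OF card_image_le cV]) (simp add: V_def fin)
  ultimately have "card (Pair 0 ` V :: ('a \<times> 'a) set) + card (\<Union>s\<in>H. (\<lambda>x. (x, s * x)) ` L s)
      \<le> (q - 1) + q ^ 2 * (q - 1)"
    by (intro add_mono)
  moreover have "U - {(0, 0)} \<subseteq> Pair 0 ` V \<union> (\<Union>s\<in>H. (\<lambda>x. (x, s * x)) ` L s)"
  proof
    fix v assume v: "v \<in> U - {(0, 0)}"
    obtain x y where xy: "v = (x, y)" by (cases v)
    show "v \<in> Pair 0 ` V \<union> (\<Union>s\<in>H. (\<lambda>x. (x, s * x)) ` L s)"
    proof (cases "x = 0")
      case False
      then have "y / x \<in> H" "x \<in> L (y / x)" "v = (x, y / x * x)"
        using xy v slope by (auto simp: L_def)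
      then show ?thesis by blast
    qed (use xy v in \<open>auto simp: V_def\<close>)
  qed
  then have "card (U - {(0, 0)}) \<le> card (Pair 0 ` V \<union> (\<Union>s\<in>H. (\<lambda>x. (x, s * x)) ` L s))"
    by (intro card_mono) (auto simp: V_def L_def fin finite_H)
  then have "q ^ 3 - 1 \<le> card (Pair 0 ` V :: ('a \<times> 'a) set) + card (\<Union>s\<in>H. (\<lambda>x. (x, s * x)) ` L s)"
    using card_Un_le[of "Pair 0 ` V :: ('a \<times> 'a) set" "\<Union>s\<in>H. (\<lambda>x. (x, s * x)) ` L s"] zero card_U
    by (simp add: card_Diff_singleton)
  ultimately have "q ^ 3 - 1 \<le> (q - 1) + q ^ 2 * (q - 1)"
    by (rule order_trans[rotated])
  moreover have "q ^ 3 = q ^ 2 * (q - 1) + q ^ 2"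
  proof -
    have "q ^ 3 = q ^ 2 * ((q - 1) + 1)"
      using q_gt_1 by (simp add: power2_eq_square power3_eq_cube)
    then show ?thesis by (simp only: distrib_left mult_1_right)
  qed
  moreover have "q < q ^ 2"
    using power_strict_increasing[of 1 2 q] q_gt_1 by simp
  \<comment> \<open>Used with \<open>a = q ^ 2 * (q - 1)\<close>, \<open>b = q ^ 2\<close> and
    \<open>c = q ^ 3\<close>: naming the powers leaves a linear problem with truncated
    subtraction.\<close>
  moreover have False if "c - 1 \<le> q - 1 + a" "c = a + b" "q < b" for a b c
    using that q_gt_1 by linarith
  ultimately show False by blast
qed

end

section \<open>Existence of the cubic extension\<close>

text \<open>Multiplication by a nonzero \<open>x\<close> permutes the nonzero elements, so their
  product absorbs the factor \<open>x ^ (CARD('k) - 1)\<close>.\<close>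

lemma finite_field_power_card:
  fixes x :: "'k::field"
  assumes "finite (UNIV :: 'k set)"
  shows "x ^ CARD('k) = x"
proof (cases "x = 0")
  case True
  then show ?thesis using assms by (simp add: power_0_left card_eq_0_iff)
next
  case False
  define P where "P = (\<Prod>y\<in>UNIV - {0}. y :: 'k)"
  have "P = (\<Prod>y\<in>UNIV - {0}. x * y)"
    unfolding P_def
    by (rule prod.reindex_bij_witness[where j = "\<lambda>y. y / x" and i = "\<lambda>y. x * y"])
      (use False in auto)
  also have "\<dots> = x ^ card (UNIV - {0 :: 'k}) * P"
    by (simp add: prod.distrib P_def)
  finally have "x ^ card (UNIV - {0 :: 'k}) = 1"
    using assms by (simp add: P_def)
  then have "x ^ (CARD('k) - 1) * x = x"
    using assms by (simp add: card_Diff_singleton)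
  moreover have "CARD('k) > 0" using assms by (simp add: card_gt_0_iff)
  ultimately show ?thesis by (metis power_minus_mult)
qed

text \<open>Identifies the prime below \<open>q\<close> with the characteristic, as required for the
  additivity of the \<open>q\<close>-th power.\<close>

lemma card_eq_CHAR_power:
  assumes "primepow CARD('k::field)"
  obtains n where "normalization_semidom_class.prime CHAR('k)" "CARD('k) = CHAR('k) ^ n" "n > 0"
proof -
  obtain p k where p: "normalization_semidom_class.prime p" "k > 0" "CARD('k) = p ^ k"
    using assms by (auto simp: primepow_def)
  then have "finite (UNIV :: 'k set)"
    by (metis card_ge_0_finite prime_gt_0_nat zero_less_power)
  then have "normalization_semidom_class.prime CHAR('k)"
    by (intro prime_CHAR_semidom finite_imp_CHAR_pos)
  moreover have "CHAR('k) dvd p ^ k"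
    using CHAR_dvd_CARD[where ?'a = 'k] p by simp
  ultimately have "CHAR('k) = p"
    using p prime_dvd_power primes_dvd_imp_eq by metis
  with p that show thesis by simp
qed

text \<open>The polynomial \<open>X\<^sup>n - X\<close> has derivative \<open>-1\<close>, so all its roots are simple.\<close>
lemma card_roots_power_eq_self:
  assumes "n > 1" and "of_nat n = (0 :: 'a::alg_closed_field)"
  shows "card {x :: 'a. x ^ n = x} = n"
proof -
  define p :: "'a poly" where "p = monom 1 n - monom 1 1"
  have poly_p: "poly p x = x ^ n - x" for x
    by (simp add: p_def poly_monom)
  have "poly.coeff p n = 1" "\<And>i. i > n \<Longrightarrow> poly.coeff p i = 0"
    using assms by (auto simp: p_def)
  then have deg: "degree p = n"
    by (metis degree_le le_antisym le_degree zero_neq_one)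
  then have "p \<noteq> 0" using assms by auto
  then obtain A where A: "size A = n" "p = smult (lead_coeff p) (\<Prod>x\<in>#A. [:- x, 1:])"
    using alg_closed_imp_factorization deg by metis
  have pd: "poly (pderiv p) x = -1" for x
    using assms by (simp add: p_def pderiv_diff pderiv_monom poly_monom)
  have root_iff: "x ^ n = x \<longleftrightarrow> x \<in># A" for x
  proof -
    have "x ^ n = x \<longleftrightarrow> poly p x = 0" by (simp add: poly_p)
    also have "\<dots> \<longleftrightarrow> poly (\<Prod>x\<in>#A. [:- x, 1:]) x = 0"
      using \<open>p \<noteq> 0\<close> by (subst A(2)) simp
    also have "\<dots> \<longleftrightarrow> x \<in># A"
      by (auto simp: poly_prod_mset prod_mset_zero_iff)
    finally show ?thesis .
  qed
  have "count A x = 1" if x: "x \<in># A" for x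
  proof (rule ccontr)
    assume *: "count A x \<noteq> 1"
    obtain B where B: "A = add_mset x B"
      using multi_member_split[OF x] by blast
    with * have "count B x \<noteq> 0" by simp
    then have "x \<in># B" using not_in_iff by metis
    then obtain C where "B = add_mset x C"
      using multi_member_split[of x B] by blast
    with B A have "p = smult (lead_coeff p) ([:- x, 1:] * ([:- x, 1:] * (\<Prod>x\<in>#C. [:- x, 1:])))"
      by simp
    then obtain r where "p = [:- x, 1:] * ([:- x, 1:] * r)"
      by (metis mult_smult_right)
    then have "poly (pderiv p) x = 0"
      by (simp add: pderiv_mult del: mult_pCons_left)
    with pd show False by simp
  qed
  then have "size A = card (set_mset A)"
    by (simp add: size_multiset_overloaded_eq)
  moreover have "{x. x ^ n = x} = set_mset A"
    using root_iff by auto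
  ultimately show ?thesis using A by simp
qed

text \<open>The closure contains all roots of \<open>X^q - X\<close> and of
  \<open>X^(q^3) - X\<close>, which are distinct because \<open>q\<close> is 0 there. The
  \<open>q\<close> elements of \<open>'k\<close> already exhaust the roots of the former.\<close>

lemma cubic_extension_alg_closure:
  assumes "primepow q" and "CARD('k::field) = q"
  shows "cubic_extension TYPE('k alg_closure) q"
    and "range (to_ac :: 'k \<Rightarrow> _) = cubic_extension.F q"
proof -
  obtain n where n: "normalization_semidom_class.prime CHAR('k)" "q = CHAR('k) ^ n" "n > 0"
    using card_eq_CHAR_power assms by metis
  have q1: "q > 1"
    using n prime_gt_1_nat one_less_power by blast
  have zero: "of_nat q = (0 :: 'k alg_closure)"
    using n by (simp add: of_nat_eq_0_iff_char_dvd)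
  have c1: "card {x :: 'k alg_closure. x ^ q = x} = q"
    using q1 zero by (rule card_roots_power_eq_self)
  have "card {x :: 'k alg_closure. x ^ (q ^ 3) = x} = q ^ 3"
    using zero one_less_power[OF q1, of 3] by (intro card_roots_power_eq_self) auto
  then have c3: "card {x :: 'k alg_closure. ((x ^ q) ^ q) ^ q = x} = q ^ 3"
    by (simp add: power_mult[symmetric] power3_eq_cube mult.assoc)
  show ext: "cubic_extension TYPE('k alg_closure) q"
    using q1 c1 c3 n by unfold_locales (auto intro: freshmans_dream')
  interpret cubic_extension q "TYPE('k alg_closure)" by (rule ext)
  have "finite (UNIV :: 'k set)"
    using assms q1 by (auto intro: card_ge_0_finite)
  then have "range (to_ac :: 'k \<Rightarrow> _) \<subseteq> F"
    using finite_field_power_card assms by (auto simp: F_def simp flip: to_ac_power)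
  moreover have "card (range (to_ac :: 'k \<Rightarrow> _)) = q"
    using assms by (simp add: card_image inj_to_ac)
  ultimately show "range (to_ac :: 'k \<Rightarrow> _) = F"
    by (intro card_subset_eq) (simp_all add: finite_F card_F)
qed

section \<open>Symplectic spaces over finite fields\<close>

context vector_space
begin

lemma card_span_independent:
  assumes "finite (UNIV :: 'a set)" "independent B" "finite B"
  shows "card (span B) = CARD('a) ^ card B"
proof -
  define \<phi> where "\<phi> u = (\<Sum>v\<in>B. scale (u v) v)" for u
  have "inj_on \<phi> (B \<rightarrow>\<^sub>E UNIV)"
  proof (rule inj_onI)
    fix u w assume uw: "u \<in> B \<rightarrow>\<^sub>E UNIV" "w \<in> B \<rightarrow>\<^sub>E UNIV" "\<phi> u = \<phi> w"
    then have "(\<Sum>v\<in>B. scale (u v - w v) v) = 0"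
      by (simp add: \<phi>_def scale_left_diff_distrib sum_subtractf)
    then have "u v - w v = 0" if "v \<in> B" for v
      using independentD[OF assms(2,3) subset_refl, of "\<lambda>v. u v - w v"] that by simp
    with uw show "u = w" by (intro PiE_ext) auto
  qed
  moreover have "\<phi> ` (B \<rightarrow>\<^sub>E UNIV) = span B"
  proof -
    \<comment> \<open>\<open>span_finite\<close> allows arbitrary coefficient functions; restricting
      one to \<open>B\<close> leaves its combination unchanged.\<close>
    have "\<phi> u \<in> \<phi> ` (B \<rightarrow>\<^sub>E UNIV)" for u
      by (rule image_eqI[of _ _ "restrict u B"]) (simp_all add: \<phi>_def)
    then show ?thesis
      by (auto simp: span_finite[OF assms(3)] \<phi>_def)
  qed
  ultimately have "card (span B) = card (B \<rightarrow>\<^sub>E (UNIV :: 'a set))"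
    using card_image by metis
  then show ?thesis using assms by (simp add: card_PiE)
qed

text \<open>An infinite basis has cardinality 0, so positive dimension guarantees a finite
  one.\<close>

lemma finite_UNIV_of_dim_pos:
  assumes "finite (UNIV :: 'a set)" "dim (UNIV :: 'b set) > 0"
  shows "finite (UNIV :: 'b set)"
proof -
  obtain B where "independent B" "span B = UNIV" "card B = dim (UNIV :: 'b set)"
    using basis_exists[of UNIV] by (metis top.extremum_uniqueI)
  then show ?thesis
    using assms card_span_independent[of B] by (metis card_ge_0_finite zero_less_power zero_less_card_finite finite_UNIV_card_ge_0)
qed

lemma card_subspace_eq_power:
  assumes "finite (UNIV :: 'a set)" "finite W" "subspace W"
  shows "card W = CARD('a) ^ dim W"
proof -
  obtain B where B: "B \<subseteq> W" "independent B" "W \<subseteq> span B" "card B = dim W"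
    using basis_exists by metis
  then have "span B = W"
    using span_subspace assms(3) by blast
  then show ?thesis
    using card_span_independent[of B] B assms finite_subset by metis
qed

end

section \<open>Hyperbolic pairs in a symplectic space\<close>

context symplectic_space
begin

lemma form_add_left: "form (x + y) z = form x z + form y z"
  and form_scale_left: "form (scale c x) z = c * form x z"
  using linear_left[of z] by (simp_all add: Vector_Spaces.linear_iff)

lemma form_add_right: "form z (x + y) = form z x + form z y"
  and form_scale_right: "form z (scale c x) = c * form z x"
  using linear_right[of z] by (simp_all add: Vector_Spaces.linear_iff)

lemma form_diff_left: "form (x - y) z = form x z - form y z"
  using form_add_left[of "x - y" y z] by simp

lemma form_diff_right: "form z (x - y) = form z x - form z y"
  using form_add_right[of z "x - y" y] by simp

lemma form_0_left: "form 0 z = 0"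
  using form_scale_left[of 0 0 z] by simp

lemma form_0_right: "form z 0 = 0"
  using form_scale_right[of z 0 0] by simp

lemma form_skew: "form x y = - form y x"
proof -
  have "form (x + y) (x + y) = form x y + form y x"
    by (simp only: form_add_left form_add_right) (simp add: alternating)
  then show ?thesis
    by (simp add: alternating eq_neg_iff_add_eq_0)
qed

lemma form_sum_left: "form (\<Sum>i\<in>I. g i) z = (\<Sum>i\<in>I. form (g i) z)"
  by (induction I rule: infinite_finite_induct) (simp_all add: form_add_left form_0_left)

lemma form_sum_right: "form z (\<Sum>i\<in>I. g i) = (\<Sum>i\<in>I. form z (g i))"
  by (induction I rule: infinite_finite_induct) (simp_all add: form_add_right form_0_right)

definition hyperbolic_pairs :: "nat \<Rightarrow> (nat \<Rightarrow> 'v) \<Rightarrow> (nat \<Rightarrow> 'v) \<Rightarrow> bool" where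
  "hyperbolic_pairs n e f \<longleftrightarrow>
     (\<forall>i<n. \<forall>j<n. form (e i) (e j) = 0 \<and> form (f i) (f j) = 0 \<and> form (e i) (f j) = of_bool (i = j))"

text \<open>Symplectic Gram-Schmidt: \<open>P\<close> projects onto the orthogonal complement of the
  pairs found so far, and a new pair is taken from its image. If \<open>P\<close> were zero, those
  \<open>2 * n\<close> vectors would span the space.\<close>

lemma hyperbolic_pairs_exist:
  assumes "2 * n \<le> dim (UNIV :: 'v set)"
  obtains e f where "hyperbolic_pairs n e f"
  using assms
proof (induction n arbitrary: thesis)
  case 0
  then show ?case by (auto simp: hyperbolic_pairs_def)
next
  case (Suc n)
  obtain e f where ef: "hyperbolic_pairs n e f"
    by (rule Suc.IH) (use Suc.prems in auto)
  define P where "P v = v + (\<Sum>i<n. scale (form (f i) v) (e i) - scale (form (e i) v) (f i))" for v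
  have orth: "form (P v) (e j) = 0" "form (P v) (f j) = 0" if "j < n" for v j
  proof -
    have fe: "form (f i) (e j) = - of_bool (i = j)" if "i < n" for i
      using that \<open>j < n\<close> ef form_skew[of "f i" "e j"] by (auto simp: hyperbolic_pairs_def)
    have "form (P v) (e j) = form v (e j) + (\<Sum>i<n. of_bool (i = j) * form (e i) v)"
      using ef \<open>j < n\<close>
      by (auto simp: P_def form_add_left form_sum_left form_diff_left form_scale_left hyperbolic_pairs_def fe
        intro!: sum.cong)
    also have "\<dots> = 0"
      using \<open>j < n\<close> form_skew[of v "e j"] by (simp add: of_bool_def if_distrib[of "\<lambda>x. x * _"] cong: if_cong)
    finally show "form (P v) (e j) = 0" .
    have "form (P v) (f j) = form v (f j) + (\<Sum>i<n. of_bool (i = j) * form (f i) v)"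
      using ef \<open>j < n\<close>
      by (auto simp: P_def form_add_left form_sum_left form_diff_left form_scale_left hyperbolic_pairs_def
        intro!: sum.cong)
    also have "\<dots> = 0"
      using \<open>j < n\<close> form_skew[of v "f j"] by (simp add: of_bool_def if_distrib[of "\<lambda>x. x * _"] cong: if_cong)
    finally show "form (P v) (f j) = 0" .
  qed
  have "\<exists>v. P v \<noteq> 0"
  proof (rule ccontr)
    assume "\<not> (\<exists>v. P v \<noteq> 0)"
    then have "v = - (\<Sum>i<n. scale (form (f i) v) (e i) - scale (form (e i) v) (f i))" for v
      by (simp add: P_def eq_neg_iff_add_eq_0)
    moreover have "- (\<Sum>i<n. scale (form (f i) v) (e i) - scale (form (e i) v) (f i))
        \<in> span (e ` {..<n} \<union> f ` {..<n})" for v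
      by (intro span_neg span_sum span_diff span_scale span_base) auto
    ultimately have "UNIV \<subseteq> span (e ` {..<n} \<union> f ` {..<n})"
      by (metis subsetI)
    then have "dim (UNIV :: 'v set) \<le> card (e ` {..<n} \<union> f ` {..<n})"
      by (intro dim_le_card) auto
    also have "\<dots> \<le> n + n"
      using card_Un_le card_image_le[of "{..<n}"] by (metis add_mono card_lessThan finite_lessThan order_trans)
    finally show False using Suc.prems by simp
  qed
  then obtain v w where vw: "form (P v) w \<noteq> 0"
    using nondegenerate by blast
  \<comment> \<open>\<open>P w\<close> differs from \<open>w\<close> by a combination of the
    \<open>e i\<close> and \<open>f i\<close>, all orthogonal to \<open>P v\<close>.\<close>
  have PP: "form (P v) (P w) = form (P v) w"
    by (subst (2) P_def) (simp add: form_add_right form_sum_right form_diff_right form_scale_right orth)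
  define e' where "e' = e(n := P v)"
  define f' where "f' = f(n := scale (1 / form (P v) w) (P w))"
  have orth': "form (e j) (P v) = 0" "form (f j) (P v) = 0" if "j < n" for v j
    using orth[OF that, of v] form_skew[of _ "P v"] by simp_all
  have "hyperbolic_pairs (Suc n) e' f'"
    using ef orth orth' vw PP
    by (auto simp: hyperbolic_pairs_def e'_def f'_def less_Suc_eq alternating form_scale_left form_scale_right)
  then show ?case by (rule Suc.prems(1))
qed

lemma form_hyperbolic_combination:
  assumes ef: "hyperbolic_pairs n e f"
  shows "form (\<Sum>i<n. scale (a i) (e i) + scale (b i) (f i)) (\<Sum>i<n. scale (c i) (e i) + scale (d i) (f i))
    = (\<Sum>i<n. a i * d i - b i * c i)"
proof -
  define w where "w = (\<Sum>i<n. scale (c i) (e i) + scale (d i) (f i))"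
  have "form (e j) w = d j" if "j < n" for j
  proof -
    have "form (e j) w = (\<Sum>i<n. of_bool (j = i) * d i)"
      using that ef unfolding w_def form_sum_right
      by (auto simp: hyperbolic_pairs_def form_add_right form_scale_right intro!: sum.cong)
    then show ?thesis
      using that by (simp add: of_bool_def if_distrib[of "\<lambda>x. x * _"] cong: if_cong)
  qed
  moreover have "form (f j) w = - c j" if "j < n" for j
  proof -
    have "form (f j) w = (\<Sum>i<n. of_bool (j = i) * - c i)"
      using that ef unfolding w_def form_sum_right
      by (auto simp: hyperbolic_pairs_def form_add_right form_scale_right form_skew[of "f j" "e _"]
        intro!: sum.cong)
    then show ?thesis
      using that by (simp add: of_bool_def sum_negf if_distrib[of "\<lambda>x. x * _"] cong: if_cong)
  qed
  ultimately show ?thesis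
    unfolding w_def[symmetric] form_sum_left
    by (intro sum.cong) (simp_all add: form_add_left form_scale_left)
qed

end

section \<open>The partial spread\<close>

text \<open>An isometry from \<open>K \<times> K\<close> onto the given space. The form takes values
  in \<open>'k\<close> and the trace in the closure, so scalars are compared through
  \<open>to_ac\<close>.\<close>

locale Sp6_model = Sp6_space q scale form + cubic_extension q "TYPE('k alg_closure)"
  for q :: nat and scale :: "'k::field \<Rightarrow> 'v::ab_group_add \<Rightarrow> 'v" and form +
  fixes \<psi> :: "'k alg_closure \<times> 'k alg_closure \<Rightarrow> 'v"
  assumes range_to_ac: "range (to_ac :: 'k \<Rightarrow> _) = F"
    and bij_\<psi>: "bij_betw \<psi> (K \<times> K) UNIV"
    and \<psi>_add: "x \<in> K \<Longrightarrow> y \<in> K \<Longrightarrow> x' \<in> K \<Longrightarrow> y' \<in> K \<Longrightarrow> \<psi> (x + x', y + y') = \<psi> (x, y) + \<psi> (x', y')"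
    and \<psi>_scale: "x \<in> K \<Longrightarrow> y \<in> K \<Longrightarrow> \<psi> (to_ac c * x, to_ac c * y) = scale c (\<psi> (x, y))"
    and form_\<psi>: "x \<in> K \<Longrightarrow> y \<in> K \<Longrightarrow> x' \<in> K \<Longrightarrow> y' \<in> K \<Longrightarrow>
      to_ac (form (\<psi> (x, y)) (\<psi> (x', y'))) = Tr (x * y' - y * x')"

lemma (in Sp6_space) Sp6_model_exists:
  assumes "primepow q"
  obtains \<psi> where "Sp6_model q scale form \<psi>"
proof -
  have q: "CARD('k) = q" by (rule card_field)
  interpret cubic_extension q "TYPE('k alg_closure)"
    by (rule cubic_extension_alg_closure(1)[OF assms q])
  have range_F: "range (to_ac :: 'k \<Rightarrow> _) = F"
    by (rule cubic_extension_alg_closure(2)[OF assms q])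
  have to_of: "to_ac (of_ac t) = t" if "t \<in> F" for t :: "'k alg_closure"
    using that range_F by (auto simp: to_ac_of_ac)
  have of_add: "of_ac (s + t) = of_ac s + of_ac t" if "s \<in> F" "t \<in> F" for s t :: "'k alg_closure"
    using that by (intro of_ac_eqI) (simp add: to_of)
  have of_scale: "of_ac (to_ac c * t) = c * of_ac t" if "t \<in> F" for c and t :: "'k alg_closure"
    using that by (intro of_ac_eqI) (simp add: to_of)
  obtain b c :: "nat \<Rightarrow> 'k alg_closure" where bK: "\<And>i. b i \<in> K" and cK: "\<And>i. c i \<in> K"
    and dual: "\<And>x y. x \<in> K \<Longrightarrow> y \<in> K \<Longrightarrow> Tr (x * y) = (\<Sum>i<3. Tr (x * b i) * Tr (y * c i))"
    by (rule dual_bases) (rule that)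
  obtain e f where ef: "hyperbolic_pairs 3 e f"
    using hyperbolic_pairs_exist[of 3] dim_6 by auto
  \<comment> \<open>The first component is read in coordinates against \<open>b\<close>, the second
    against \<open>c\<close>, so \<open>dual\<close> converts the hyperbolic form into the trace
    form.\<close>
  define \<psi> where "\<psi> = (\<lambda>(x, y). \<Sum>i<3. scale (of_ac (Tr (x * b i))) (e i) + scale (of_ac (Tr (y * c i))) (f i))"
  have \<psi>_form: "to_ac (form (\<psi> (x, y)) (\<psi> (x', y'))) = Tr (x * y' - y * x')"
    if "x \<in> K" "y \<in> K" "x' \<in> K" "y' \<in> K" for x y x' y'
  proof -
    have "to_ac (form (\<psi> (x, y)) (\<psi> (x', y')))
        = (\<Sum>i<3. Tr (x * b i) * Tr (y' * c i) - Tr (y * c i) * Tr (x' * b i))"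
      using that bK cK
      by (simp add: \<psi>_def form_hyperbolic_combination[OF ef] to_ac_sum to_of)
    also have "\<dots> = Tr (x * y') - Tr (x' * y)"
      using that by (simp add: dual sum_subtractf mult.commute)
    finally show ?thesis by (simp add: Tr_diff mult.commute)
  qed
  have inj: "inj_on \<psi> (K \<times> K)"
  proof (rule inj_onI, clarify)
    fix x y x' y' assume K: "x \<in> K" "y \<in> K" "x' \<in> K" "y' \<in> K" and eq: "\<psi> (x, y) = \<psi> (x', y')"
    \<comment> \<open>Equal images pair equally with every \<open>\<psi> (s, t)\<close>; setting
      \<open>s = 0\<close> and then \<open>t = 0\<close> separates the two components.\<close>
    have *: "Tr (x * t - y * s) = Tr (x' * t - y' * s)" if "s \<in> K" "t \<in> K" for s t
      using \<psi>_form[of x y s t] \<psi>_form[of x' y' s t] that K eq by simp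
    have "x - x' = 0"
      by (rule Tr_nondegenerate) (use *[of 0] in \<open>simp add: left_diff_distrib Tr_diff\<close>)
    moreover have "y - y' = 0"
      by (rule Tr_nondegenerate) (use *[of _ 0] in \<open>simp add: left_diff_distrib Tr_diff Tr_minus\<close>)
    ultimately show "x = x' \<and> y = y'" by simp
  qed
  have fin: "finite (UNIV :: 'k set)"
    using q q_gt_1 by (auto intro: card_ge_0_finite)
  have fin_v: "finite (UNIV :: 'v set)"
    using finite_UNIV_of_dim_pos[OF fin] dim_6 by simp
  have "card (\<psi> ` (K \<times> K)) = CARD('v)"
    using card_subspace_eq_power[OF fin fin_v] inj
    by (simp add: card_image card_cartesian_product card_K dim_6 q flip: power_add)
  then have "\<psi> ` (K \<times> K) = UNIV"
    using fin_v by (intro card_subset_eq) auto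
  with inj have bij: "bij_betw \<psi> (K \<times> K) UNIV"
    by (simp add: bij_betw_def)
  have add: "\<psi> (x + x', y + y') = \<psi> (x, y) + \<psi> (x', y')"
    if "x \<in> K" "y \<in> K" "x' \<in> K" "y' \<in> K" for x y x' y'
    using that bK cK
    by (simp add: \<psi>_def distrib_right Tr_add of_add scale_left_distrib sum.distrib add_ac)
  have scal: "\<psi> (to_ac a * x, to_ac a * y) = scale a (\<psi> (x, y))" if "x \<in> K" "y \<in> K" for a x y
  proof -
    have "to_ac a \<in> F" using range_F by auto
    then have "Tr (to_ac a * z) = to_ac a * Tr z" for z
      by (rule Tr_scale)
    then show ?thesis
      using that bK cK
      by (simp add: \<psi>_def mult.assoc of_scale scale_sum_right scale_right_distrib)
  qed
  have "Sp6_model q scale form \<psi>"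
    by unfold_locales (fact range_F bij add scal \<psi>_form)+
  then show thesis by (rule that)
qed

section \<open>Lagrangian subspaces and the partial spread\<close>

context Sp6_model
begin

lemma finite_scalars: "finite (UNIV :: 'k set)"
  using card_field q_gt_1 by (auto intro: card_ge_0_finite)

lemma finite_vectors: "finite (UNIV :: 'v set)"
  using bij_\<psi> finite_K bij_betw_finite by blast

lemma \<psi>_0: "\<psi> (0, 0) = 0"
  using \<psi>_scale[of 0 0 0] by simp

lemma \<psi>_eq_iff: "p \<in> K \<times> K \<Longrightarrow> p' \<in> K \<times> K \<Longrightarrow> \<psi> p = \<psi> p' \<longleftrightarrow> p = p'"
  using bij_\<psi> by (auto simp: bij_betw_def inj_on_def)

lemma card_eq_dim_3: "subspace W \<Longrightarrow> dim W = 3 \<longleftrightarrow> card W = q ^ 3"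
  using card_subspace_eq_power[OF finite_scalars finite_subset[OF subset_UNIV finite_vectors]]
    card_field q_gt_1 by simp

text \<open>Dimension 3 over \<open>F\<close> is expressed by cardinality. That zero belongs to
  \<open>L\<close> follows from \<open>c = 0\<close>, since \<open>L\<close> is nonempty.\<close>

definition Lagrangian :: "('k alg_closure \<times> 'k alg_closure) set \<Rightarrow> bool" where
  "Lagrangian L \<longleftrightarrow> L \<subseteq> K \<times> K \<and> card L = q ^ 3 \<and>
     (\<forall>(x, y)\<in>L. \<forall>(x', y')\<in>L. (x + x', y + y') \<in> L \<and> Tr (x * y' - y * x') = 0) \<and>
     (\<forall>c\<in>F. \<forall>(x, y)\<in>L. (c * x, c * y) \<in> L)"

lemma Lagrangian_image:
  assumes L: "Lagrangian L"
  shows "subspace (\<psi> ` L)" "dim (\<psi> ` L) = 3" "totally_isotropic (\<psi> ` L)"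
proof -
  have XK: "L \<subseteq> K \<times> K" and card: "card L = q ^ 3"
    and add: "\<And>x y x' y'. (x, y) \<in> L \<Longrightarrow> (x', y') \<in> L \<Longrightarrow> (x + x', y + y') \<in> L"
    and iso: "\<And>x y x' y'. (x, y) \<in> L \<Longrightarrow> (x', y') \<in> L \<Longrightarrow> Tr (x * y' - y * x') = 0"
    and scal: "\<And>c x y. c \<in> F \<Longrightarrow> (x, y) \<in> L \<Longrightarrow> (c * x, c * y) \<in> L"
    using L unfolding Lagrangian_def by fast+
  have mem: "x \<in> K" "y \<in> K" if "(x, y) \<in> L" for x y
    using XK that by auto
  show sub: "subspace (\<psi> ` L)"
  proof (rule subspaceI)
    have "L \<noteq> {}" using card q_gt_1 by auto
    then obtain x y where "(x, y) \<in> L" by auto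
    then have "(0, 0) \<in> L" using scal[of 0 x y] by simp
    then show "0 \<in> \<psi> ` L" using \<psi>_0 by (metis image_eqI)
  next
    fix v w assume "v \<in> \<psi> ` L" "w \<in> \<psi> ` L"
    then obtain x y x' y' where "(x, y) \<in> L" "(x', y') \<in> L" "v = \<psi> (x, y)" "w = \<psi> (x', y')"
      by auto
    then show "v + w \<in> \<psi> ` L"
      using \<psi>_add[of x y x' y'] add mem by (metis image_eqI)
  next
    fix c v assume "v \<in> \<psi> ` L"
    then obtain x y where "(x, y) \<in> L" "v = \<psi> (x, y)" by auto
    then show "scale c v \<in> \<psi> ` L"
      using \<psi>_scale[of x y c] scal mem range_to_ac by (metis image_eqI rangeI)
  qed
  have "card (\<psi> ` L) = q ^ 3"
    using card bij_\<psi> XK by (metis bij_betw_def card_image inj_on_subset)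
  then show "dim (\<psi> ` L) = 3" by (simp add: card_eq_dim_3[OF sub])
  show "totally_isotropic (\<psi> ` L)"
    unfolding totally_isotropic_def
  proof (intro ballI)
    fix v w assume "v \<in> \<psi> ` L" "w \<in> \<psi> ` L"
    then obtain x y x' y' where "(x, y) \<in> L" "(x', y') \<in> L" "v = \<psi> (x, y)" "w = \<psi> (x', y')"
      by auto
    then show "form v w = 0"
      using form_\<psi>[of x y x' y'] iso mem by (metis to_ac_eq_0_iff)
  qed
qed

lemma Lagrangian_vimage:
  assumes "subspace U" "dim U = 3" "totally_isotropic U"
  shows "Lagrangian {p\<in>K \<times> K. \<psi> p \<in> U}"
proof -
  have "U \<subseteq> \<psi> ` {p\<in>K \<times> K. \<psi> p \<in> U}"
  proof
    fix v assume "v \<in> U"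
    moreover obtain p where "p \<in> K \<times> K" "v = \<psi> p"
      using bij_\<psi> unfolding bij_betw_def by (metis UNIV_I imageE)
    ultimately show "v \<in> \<psi> ` {p\<in>K \<times> K. \<psi> p \<in> U}" by blast
  qed
  then have "bij_betw \<psi> {p\<in>K \<times> K. \<psi> p \<in> U} U"
    by (intro bij_betw_subset[OF bij_\<psi>]) auto
  then have "card {p\<in>K \<times> K. \<psi> p \<in> U} = card U"
    by (rule bij_betw_same_card)
  then have "card {p\<in>K \<times> K. \<psi> p \<in> U} = q ^ 3"
    using card_eq_dim_3[OF assms(1)] assms(2) by simp
  moreover have "\<psi> (c * x, c * y) \<in> U" if "c \<in> F" "x \<in> K" "y \<in> K" "\<psi> (x, y) \<in> U" for c x y
  proof -
    obtain a where "c = to_ac a" using \<open>c \<in> F\<close> range_to_ac by auto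
    then show ?thesis using that \<psi>_scale assms by (simp add: subspace_scale)
  qed
  moreover have "Tr (x * y' - y * x') = 0"
    if "x \<in> K" "y \<in> K" "\<psi> (x, y) \<in> U" "x' \<in> K" "y' \<in> K" "\<psi> (x', y') \<in> U" for x y x' y'
    using that form_\<psi>[of x y x' y'] assms(3) by (simp add: totally_isotropic_def)
  ultimately show ?thesis
    using assms by (auto simp: Lagrangian_def \<psi>_add subspace_add)
qed

definition line :: "'k alg_closure \<Rightarrow> ('k alg_closure \<times> 'k alg_closure) set" where
  "line s = (\<lambda>x. (x, s * x)) ` K"

lemma Lagrangian_line:
  assumes "s \<in> K"
  shows "Lagrangian (line s)"
proof -
  have "card (line s) = q ^ 3"
    by (simp add: line_def card_image inj_on_def card_K)
  then show ?thesis
    using assms by (auto simp: Lagrangian_def line_def algebra_simps image_iff)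
qed

text \<open>\<open>F\<close> multiplies \<open>H\<close> into itself, so
  \<open>x * y' - y * x'\<close> lies in the kernel of the trace.\<close>

lemma Lagrangian_F_H: "Lagrangian (F \<times> H)"
proof -
  have "card (F \<times> H) = q ^ 3"
    by (simp add: card_cartesian_product card_F card_H power2_eq_square power3_eq_cube)
  moreover have "Tr (x * y' - y * x') = 0" if "x \<in> F" "x' \<in> F" "y \<in> H" "y' \<in> H" for x x' y y'
  proof -
    have "x * y' - x' * y \<in> H" using that by (intro H_closed)
    then show ?thesis by (simp add: H_def mult.commute)
  qed
  ultimately show ?thesis
    by (auto simp: Lagrangian_def H_imp_K)
qed

lemma line_Int_line: "s \<noteq> s' \<Longrightarrow> line s \<inter> line s' = {(0, 0)}"
  by (auto simp: line_def)

text \<open>A common vector \<open>(x, s * x)\<close> with \<open>x\<close> nonzero in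
  \<open>F\<close> would put \<open>s\<close> itself into \<open>H\<close>.\<close>

lemma F_H_Int_line:
  assumes "s \<in> K" "s \<notin> H"
  shows "F \<times> H \<inter> line s = {(0, 0)}"
proof -
  have "x = 0" if "x \<in> F" "s * x \<in> H" for x
  proof (rule ccontr)
    assume "x \<noteq> 0"
    have "1 / x * (s * x) \<in> H"
      by (rule H_closed(4)[OF F_closed(7)[OF F_closed(2)]]) (fact that)+
    with \<open>x \<noteq> 0\<close> assms show False by simp
  qed
  then show ?thesis by (auto simp: line_def)
qed

lemma image_Int_eq_0:
  assumes "Lagrangian L" "Lagrangian M" "L \<inter> M = {(0, 0)}"
  shows "\<psi> ` L \<inter> \<psi> ` M = {0}"
proof -
  have "L \<subseteq> K \<times> K" "M \<subseteq> K \<times> K"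
    using assms by (auto simp: Lagrangian_def)
  then have "\<psi> ` L \<inter> \<psi> ` M = \<psi> ` (L \<inter> M)"
    using bij_\<psi> by (intro inj_on_image_Int[symmetric, of _ "K \<times> K"]) (auto simp: bij_betw_def)
  then show ?thesis using assms \<psi>_0 by simp
qed

lemma neq_of_Int_eq_0:
  assumes "Lagrangian L" "\<psi> ` L \<inter> V = {0}"
  shows "\<psi> ` L \<noteq> V"
proof
  assume "\<psi> ` L = V"
  then have "card (\<psi> ` L) = 1" using assms by simp
  moreover have "card (\<psi> ` L) = q ^ 3"
    using Lagrangian_image[OF assms(1)] card_eq_dim_3 by blast
  ultimately show False using q_gt_1 by simp
qed

definition spread :: "'v set set" where
  "spread = insert (\<psi> ` (F \<times> H)) ((\<lambda>s. \<psi> ` line s) ` (K - H))"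

lemma card_spread: "card spread = q ^ 3 - q ^ 2 + 1"
proof -
  have "inj_on (\<lambda>s. \<psi> ` line s) (K - H)"
  proof (rule inj_onI, rule ccontr)
    fix s s' assume "s \<in> K - H" "s' \<in> K - H" "\<psi> ` line s = \<psi> ` line s'" "s \<noteq> s'"
    then show False
      using neq_of_Int_eq_0 image_Int_eq_0 line_Int_line Lagrangian_line by (metis DiffD1)
  qed
  then have "card ((\<lambda>s. \<psi> ` line s) ` (K - H)) = q ^ 3 - q ^ 2"
    using finite_H H_imp_K by (simp add: card_image card_Diff_subset card_K card_H subset_iff)
  moreover have "\<psi> ` (F \<times> H) \<notin> (\<lambda>s. \<psi> ` line s) ` (K - H)"
  proof
    assume "\<psi> ` (F \<times> H) \<in> (\<lambda>s. \<psi> ` line s) ` (K - H)"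
    then obtain s where s: "s \<in> K" "s \<notin> H" "\<psi> ` (F \<times> H) = \<psi> ` line s" by blast
    have "\<psi> ` (F \<times> H) \<inter> \<psi> ` line s = {0}"
      using s by (intro image_Int_eq_0 Lagrangian_F_H Lagrangian_line F_H_Int_line)
    then have "\<psi> ` (F \<times> H) \<noteq> \<psi> ` line s"
      by (rule neq_of_Int_eq_0[OF Lagrangian_F_H])
    with s show False by simp
  qed
  ultimately show ?thesis
    using finite_K by (simp add: spread_def)
qed

lemma spread_partial: "symplectic_partial_spread spread"
proof -
  have "U \<inter> W = {0}" if UW: "U \<in> spread" "W \<in> spread" "U \<noteq> W" for U W
  proof -
    have LL: "\<psi> ` line s \<inter> \<psi> ` line s' = {0}" if "s \<in> K" "s' \<in> K" "s \<noteq> s'" for s s'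
      using that by (intro image_Int_eq_0 Lagrangian_line line_Int_line)
    have FH: "\<psi> ` (F \<times> H) \<inter> \<psi> ` line s = {0}" if "s \<in> K - H" for s
      using that by (intro image_Int_eq_0 Lagrangian_line Lagrangian_F_H F_H_Int_line) auto
    consider "U = \<psi> ` (F \<times> H)" "W \<in> (\<lambda>s. \<psi> ` line s) ` (K - H)"
      | "W = \<psi> ` (F \<times> H)" "U \<in> (\<lambda>s. \<psi> ` line s) ` (K - H)"
      | "U \<in> (\<lambda>s. \<psi> ` line s) ` (K - H)" "W \<in> (\<lambda>s. \<psi> ` line s) ` (K - H)"
      using UW unfolding spread_def by blast
    then show ?thesis
    proof cases
      case 1
      then show ?thesis using FH by blast
    next
      case 2
      then show ?thesis using FH by blast
    next
      case 3
      then obtain s s' where "s \<in> K" "s' \<in> K" "U = \<psi> ` line s" "W = \<psi> ` line s'" by auto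
      with \<open>U \<noteq> W\<close> LL show ?thesis by metis
    qed
  qed
  moreover have "\<exists>L. Lagrangian L \<and> U = \<psi> ` L" if "U \<in> spread" for U
    using that Lagrangian_F_H Lagrangian_line by (auto simp: spread_def)
  ultimately show ?thesis
    unfolding symplectic_partial_spread_def using Lagrangian_image by metis
qed

lemma spread_maximal: "maximal_symplectic_partial_spread spread"
  unfolding maximal_symplectic_partial_spread_def
proof (intro conjI notI spread_partial)
  assume "\<exists>T. symplectic_partial_spread T \<and> spread \<subset> T"
  then obtain T U where T: "symplectic_partial_spread T" "spread \<subseteq> T" and U: "U \<in> T" "U \<notin> spread"
    by blast
  then have U_lag: "subspace U" "dim U = 3" "totally_isotropic U"
    by (auto simp: symplectic_partial_spread_def)
  have disj: "U \<inter> W = {0}" if "W \<in> spread" for W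
    using that T U by (metis subsetD symplectic_partial_spread_def)
  define L where "L = {p\<in>K \<times> K. \<psi> p \<in> U}"
  have L: "Lagrangian L" unfolding L_def using U_lag by (rule Lagrangian_vimage)
  have disjL: "p = (0, 0)" if "p \<in> L" "p \<in> M" "\<psi> ` M \<in> spread" for p M
  proof -
    have "\<psi> p = \<psi> (0, 0)"
      using that disj[OF that(3)] \<psi>_0 by (auto simp: L_def)
    then show ?thesis using that by (subst (asm) \<psi>_eq_iff) (auto simp: L_def)
  qed
  have "avoiding_subspace q L"
  proof (unfold_locales, goal_cases)
    \<comment> \<open>If the slope were outside \<open>H\<close>, the line through
      \<open>(x, y)\<close> would belong to \<open>spread\<close>, forcing \<open>(x, y)\<close> to
      be zero.\<close>
    case (5 x y)
    then have "y / x \<in> K" "(x, y) \<in> line (y / x)" by (auto simp: L_def line_def)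
    then show ?case using disjL[OF 5(1)] 5(2) by (auto simp: spread_def)
  next
    case (6 c h)
    then show ?case using disjL[OF 6(1), of "F \<times> H"] by (auto simp: spread_def)
  qed (use L in \<open>unfold Lagrangian_def, fast+\<close>)
  then show False by (rule avoiding_subspace.contradiction)
qed

end

theorem theorem8p1:
  fixes q :: nat
    and scale :: "'k::field \<Rightarrow> 'v::ab_group_add \<Rightarrow> 'v"
    and form :: "'v \<Rightarrow> 'v \<Rightarrow> 'k"
  assumes "primepow q"
    and "Sp6_space q scale form"
  shows "\<exists>S. Sp6_space.maximal_symplectic_partial_spread scale form S \<and>
             card S = q ^ 3 - q ^ 2 + 1"
proof -
  obtain \<psi> where "Sp6_model q scale form \<psi>"
    using Sp6_space.Sp6_model_exists[OF assms(2,1)] by blast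
  then interpret Sp6_model q scale form \<psi> .
  show ?thesis
    by (rule exI[of _ spread], rule conjI[OF spread_maximal card_spread])
qed

end
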